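(* Let $G=(V,E)$ be a finite simple undirected graph with degeneracy $d$, and let $0<\varepsilon\le 8$. Then DEC-ADG with parameter $\varepsilon$ produces a coloring of $G$ with at most $\lceil(2+\varepsilon)d\rceil$ colors.
   Context: A coloring is an assignment of colors to vertices such that no two neighboring vertices share the same color. For $U\subseteq V$, $G[U]$ is the subgraph induced on $U$ and $N_U(v)$ denotes the set of neighbors of $v$ in $U$. The degeneracy $d$ of $G$ is the smallest $s$ such that every (nonempty) induced subgraph of $G$ has a vertex of degree at most $s$. Algorithm ADG with accuracy $\eta$. Initialize $U=V$, $D[v]=\deg(v)$, $\ell=1$. While $U\ne\emptyset$: $\widehat\delta=\frac1{|U|}\sum_{v\in U}D[v]$; $R(\ell)=\{u\in U:D[u]\le(1+\eta)\widehat\delta\}$; for all $v\in R(\ell)$ and all $u\in N_U(v)$, decrement $D[u]$; $U=U\setminus R(\ell)$; set $\rho(v)=\ell$ for $v\in R(\ell)$; $\ell=\ell+1$. Let $\overline\rho$ be the number of iterations; $R(1),\dots,R(\overline\rho)$ partition $V$. Write $G(\ell)=G[R(\ell)]$. Algorithm DEC-ADG with parameter $\varepsilon$. Run ADG with accuracy $\eta=\varepsilon/12$. Put $\mu=\varepsilon/4$. Each vertex $v$ has a set $B_v$ of forbidden colors, initially empty. For $\ell=\overline\rho,\overline\rho-1,\dots,1$: let $Q=R(\overline\rho)\cup\dots\cup R(\ell+1)$ be the set of already colored vertices (empty for $\ell=\overline\rho$); for all $v\in R(\ell)$ and all $u\in N_Q(v)$ insert $C[u]$ into $B_v$; then run SIM-COL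 on $G(\ell)$ with the sets $B_v$, $v\in R(\ell)$. The array $C$ is the output coloring. SIM-COL on $G(\ell)$: let $\deg_\ell(v)=|N_{Q\cup R(\ell)}(v)|$ be the number of neighbors of $v$ in the partition being colored and in all already colored partitions. Set $U=R(\ell)$. While $U\ne\emptyset$: (1) in parallel, every $v\in U$ chooses a color $C[v]$ uniformly at random from $\{1,\dots,(1+\mu)\deg_\ell(v)\}$ (rounding of $(1+\mu)\deg_\ell(v)$ up to an integer is suppressed in the notation); (2) in parallel, every $v\in U$ for which some $u\in N_U(v)$ has chosen the same color, or for which $C[v]\in B_v$, has $C[v]$ reset to $0$; (3) for every $v\in U$ and $u\in N_U(v)$ with $C[u]>0$, insert $C[u]$ into $B_v$; then remove from $U$ all $v$ with $C[v]>0$.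
   Formalization: For d = 0 the bound is 1 color instead of 0 (a single vertex needs one color), and a vertex with deg_ℓ(v) = 0 draws from the palette {1}, since the printed palette {1,…,0} would be empty. *)

theory Defs
  imports "HOL-Probability.Probability" "HOL-Library.While_Combinator"
begin

definition simple_graph :: "'a set \<Rightarrow> 'a set set \<Rightarrow> bool" where
  "simple_graph V E \<longleftrightarrow> finite V \<and> (\<forall>e\<in>E. e \<subseteq> V \<and> card e = 2)"

definition nbrs :: "'a set set \<Rightarrow> 'a set \<Rightarrow> 'a \<Rightarrow> 'a set" where
  "nbrs E U v = {u \<in> U. {u, v} \<in> E}"

definition degeneracy :: "'a set \<Rightarrow> 'a set set \<Rightarrow> nat" where
  "degeneracy V E = (LEAST s. \<forall>W. W \<subseteq> V \<and> W \<noteq> {} \<longrightarrow> (\<exists>v\<in>W. card (nbrs E W v) \<le> s))"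

text \<open>Colors are positive integers; the value 0 means "not colored".\<close>

definition proper_coloring :: "'a set \<Rightarrow> 'a set set \<Rightarrow> ('a \<Rightarrow> nat) \<Rightarrow> bool" where
  "proper_coloring V E C \<longleftrightarrow>
     (\<forall>v\<in>V. C v > 0) \<and> (\<forall>u\<in>V. \<forall>v\<in>V. {u, v} \<in> E \<longrightarrow> C u \<noteq> C v)"

text \<open>
  ADG. The state is \<open>(U, D, [R(1), \<dots>, R(\<ell> - 1)])\<close>. A vertex \<open>u \<in> U\<close> is decremented once
  for each of its neighbors in \<open>R(\<ell>)\<close>. The result is \<open>None\<close> if the loop does not terminate.
\<close>

definition adg_step :: "'a set set \<Rightarrow> real \<Rightarrow>
    'a set \<times> ('a \<Rightarrow> int) \<times> 'a set list \<Rightarrow> 'a set \<times> ('a \<Rightarrow> int) \<times> 'a set list" where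
  "adg_step E \<eta> = (\<lambda>(U, D, Rs).
     let \<delta> = (\<Sum>v\<in>U. real_of_int (D v)) / real (card U);
         R = {u \<in> U. real_of_int (D u) \<le> (1 + \<eta>) * \<delta>}
     in (U - R, (\<lambda>u. if u \<in> U then D u - int (card (nbrs E R u)) else D u), Rs @ [R]))"

definition adg :: "'a set \<Rightarrow> 'a set set \<Rightarrow> real \<Rightarrow> 'a set list option" where
  "adg V E \<eta> = map_option (\<lambda>(U, D, Rs). Rs)
     (while_option (\<lambda>(U, D, Rs). U \<noteq> {}) (adg_step E \<eta>)
       (V, (\<lambda>v. int (card (nbrs E V v))), []))"

text \<open>
  One pass of the SIM-COL loop: \<open>c\<close> holds the colors drawn by the vertices of \<open>U\<close>, and
  \<open>C\<close>, \<open>B\<close> are the color array and the forbidden sets before the pass.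
\<close>

definition sim_col_update :: "'a set set \<Rightarrow> ('a \<Rightarrow> nat) \<Rightarrow>
    'a set \<times> ('a \<Rightarrow> nat) \<times> ('a \<Rightarrow> nat set) \<Rightarrow> 'a set \<times> ('a \<Rightarrow> nat) \<times> ('a \<Rightarrow> nat set)" where
  "sim_col_update E c = (\<lambda>(U, C, B).
     let C' = (\<lambda>v. if v \<in> U
                   then (if (\<exists>u\<in>nbrs E U v. c u = c v) \<or> c v \<in> B v then 0 else c v)
                   else C v);
         B' = (\<lambda>v. if v \<in> U then B v \<union> {C' u | u. u \<in> nbrs E U v \<and> C' u > 0} else B v)
     in (U - {v \<in> U. C' v > 0}, C', B'))"

text \<open>
  The loop may run forever on a null set of random choices, so it is a sub-probability
  distribution; the missing mass is the probability of nontermination. The vertices draw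
  independently, \<open>v\<close> from \<open>{1..k v}\<close>.
\<close>

partial_function (spmf) sim_col_loop :: "'a set set \<Rightarrow> ('a \<Rightarrow> nat) \<Rightarrow>
    'a set \<times> ('a \<Rightarrow> nat) \<times> ('a \<Rightarrow> nat set) \<Rightarrow> (('a \<Rightarrow> nat) \<times> ('a \<Rightarrow> nat set)) spmf" where
  "sim_col_loop E k s =
     (if fst s = {} then return_spmf (snd s)
      else bind_spmf (spmf_of_pmf (Pi_pmf (fst s) 0 (\<lambda>v. pmf_of_set {1..k v})))
             (\<lambda>c. sim_col_loop E k (sim_col_update E c s)))"

text \<open>
  The number of colors \<open>(1 + \<mu>) deg\<^sub>\<ell>(v)\<close> is rounded up. A vertex with \<open>deg\<^sub>\<ell>(v) = 0\<close>
  (for instance the center of a star, which ADG removes last) would draw from the empty set;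
  it gets the single color 1 instead.
\<close>

definition palette_size :: "'a set set \<Rightarrow> real \<Rightarrow> 'a set \<Rightarrow> 'a \<Rightarrow> nat" where
  "palette_size E \<mu> W v = max 1 (nat \<lceil>(1 + \<mu>) * real (card (nbrs E W v))\<rceil>)"

definition sim_col :: "'a set set \<Rightarrow> real \<Rightarrow> 'a set \<Rightarrow> 'a set \<Rightarrow>
    ('a \<Rightarrow> nat) \<Rightarrow> ('a \<Rightarrow> nat set) \<Rightarrow> (('a \<Rightarrow> nat) \<times> ('a \<Rightarrow> nat set)) spmf" where
  "sim_col E \<mu> Q R C B = sim_col_loop E (palette_size E \<mu> (Q \<union> R)) (R, C, B)"

text \<open>The list argument holds the partitions still to be colored, in the order of processing.\<close>

primrec color_partitions :: "'a set set \<Rightarrow> real \<Rightarrow> 'a set list \<Rightarrow> 'a set \<Rightarrow>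
    ('a \<Rightarrow> nat) \<Rightarrow> ('a \<Rightarrow> nat set) \<Rightarrow> ('a \<Rightarrow> nat) spmf" where
  "color_partitions E \<mu> [] Q C B = return_spmf C"
| "color_partitions E \<mu> (R # Rs) Q C B =
     bind_spmf (sim_col E \<mu> Q R C (\<lambda>v. if v \<in> R then B v \<union> C ` nbrs E Q v else B v))
       (\<lambda>(C', B'). color_partitions E \<mu> Rs (Q \<union> R) C' B')"

definition dec_adg :: "'a set \<Rightarrow> 'a set set \<Rightarrow> real \<Rightarrow> ('a \<Rightarrow> nat) spmf" where
  "dec_adg V E \<epsilon> =
     (case adg V E (\<epsilon> / 12) of
        None \<Rightarrow> return_pmf None
      | Some Rs \<Rightarrow> color_partitions E (\<epsilon> / 4) (rev Rs) {} (\<lambda>_. 0) (\<lambda>_. {}))"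

end

theory Submission
  imports Defs
begin

text \<open>
  An induced subgraph has average degree at most \<open>2 d\<close>, so a vertex removed by ADG has at most
  \<open>2 (1 + \<epsilon> / 12) d\<close> neighbors among the vertices that are not removed before it, and since
  \<open>\<epsilon> \<le> 8\<close> its palette has at most \<open>2 (1 + \<epsilon> / 4) (1 + \<epsilon> / 12) d \<le> (2 + \<epsilon>) d\<close> colors before
  rounding. SIM-COL colors properly because the forbidden set of an uncolored vertex contains the
  colors of all its colored neighbors. It terminates almost surely: a palette has more colors than
  the vertex has neighbors, so some vertex \<open>w\<close> can draw a color \<open>a\<close> that is not forbidden while its
  uncolored neighbors, whose palettes have at least two colors, all avoid \<open>a\<close>; hence every pass makes
  progress with positive probability.
\<close>

section \<open>Graphs and degeneracy\<close>

lemma finite_nbrs [simp]: "finite U \<Longrightarrow> finite (nbrs E U v)"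
  by (simp add: nbrs_def)

lemma nbrs_irrefl: "simple_graph V E \<Longrightarrow> v \<notin> nbrs E U v"
  by (auto simp: simple_graph_def nbrs_def)

lemma nbrs_Un: "nbrs E (A \<union> B) v = nbrs E A v \<union> nbrs E B v"
  by (auto simp: nbrs_def)

lemma card_nbrs_Un:
  assumes "finite A" "finite B" "A \<inter> B = {}"
  shows "card (nbrs E (A \<union> B) v) = card (nbrs E A v) + card (nbrs E B v)"
  unfolding nbrs_Un using assms by (intro card_Un_disjoint) (auto simp: nbrs_def)

text \<open>\<open>card V\<close> is an admissible bound for every \<open>W\<close>, so the
  \<open>LEAST\<close> in the definition of \<open>degeneracy\<close> is attained and has the
  defining property.\<close>

lemma degeneracy_low_degree:
  assumes "finite V" "W \<subseteq> V" "W \<noteq> {}"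
  shows "\<exists>v\<in>W. card (nbrs E W v) \<le> degeneracy V E"
proof -
  let ?P = "\<lambda>s. \<forall>W. W \<subseteq> V \<and> W \<noteq> {} \<longrightarrow> (\<exists>v\<in>W. card (nbrs E W v) \<le> s)"
  have "card (nbrs E W v) \<le> card V" if "W \<subseteq> V" for W v
    using assms(1) that by (intro card_mono) (auto simp: nbrs_def)
  hence "?P (card V)" by blast
  hence "?P (degeneracy V E)" unfolding degeneracy_def by (rule LeastI)
  thus ?thesis using assms by blast
qed

text \<open>Peel off a vertex \<open>w\<close> of degree at most the degeneracy: the degree sum
  drops by the degree of \<open>w\<close> itself and by one for each of its neighbors, hence by at
  most twice the degeneracy.\<close>

lemma sum_degrees_le:
  assumes "simple_graph V E" "U \<subseteq> V"
  shows "(\<Sum>v\<in>U. card (nbrs E U v)) \<le> 2 * degeneracy V E * card U"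
proof -
  have finV: "finite V" using assms by (simp add: simple_graph_def)
  hence "finite U" using assms(2) finite_subset by blast
  thus ?thesis using assms(2)
  proof (induction U rule: finite_psubset_induct)
    case (psubset U)
    show ?case
    proof (cases "U = {}")
      case False
      then obtain w where w: "w \<in> U" "card (nbrs E U w) \<le> degeneracy V E"
        using degeneracy_low_degree[OF finV psubset.prems] by blast
      let ?U = "U - {w}"
      have U: "U = insert w ?U" using w by blast
      have deg: "card (nbrs E U v) = card (nbrs E ?U v) + (if v \<in> nbrs E U w then 1 else 0)"
        if "v \<in> ?U" for v
      proof -
        have "nbrs E {w} v = (if v \<in> nbrs E U w then {w} else {})"
          using that w by (auto simp: nbrs_def insert_commute)
        moreover have "card (nbrs E U v) = card (nbrs E ?U v) + card (nbrs E {w} v)"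
          using card_nbrs_Un[of ?U "{w}" E v] psubset.hyps(1) w by (simp add: insert_absorb)
        ultimately show ?thesis by simp
      qed
      have "(\<Sum>v\<in>U. card (nbrs E U v)) = card (nbrs E U w) + (\<Sum>v\<in>?U. card (nbrs E U v))"
        using psubset.hyps(1) w(1) by (simp add: sum.remove)
      also have "(\<Sum>v\<in>?U. card (nbrs E U v)) =
          (\<Sum>v\<in>?U. card (nbrs E ?U v)) + (\<Sum>v\<in>?U. if v \<in> nbrs E U w then 1 else 0)"
        using deg by (simp add: sum.distrib)
      \<comment> \<open>The edges at \<open>w\<close> are counted a second time, from the side of
        its neighbors; none is lost in \<open>?U\<close> because \<open>w\<close> is not its own
        neighbor.\<close>
      also have "(\<Sum>v\<in>?U. if v \<in> nbrs E U w then 1 else (0::nat)) = card (nbrs E U w)"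
      proof -
        have "{v \<in> ?U. v \<in> nbrs E U w} = nbrs E U w"
          using nbrs_irrefl[OF assms(1)] by (auto simp: nbrs_def)
        thus ?thesis using psubset.hyps(1) by (simp flip: sum.inter_filter)
      qed
      also have "(\<Sum>v\<in>?U. card (nbrs E ?U v)) \<le> 2 * degeneracy V E * card ?U"
        using w psubset.prems by (intro psubset.IH) auto
      finally have "(\<Sum>v\<in>U. card (nbrs E U v)) \<le>
          2 * degeneracy V E * card ?U + 2 * degeneracy V E" using w(2) by simp
      also have "\<dots> = 2 * degeneracy V E * card U"
        using card.remove[OF psubset.hyps(1) w(1)] by simp
      finally show ?thesis .
    qed simp
  qed
qed

section \<open>ADG\<close>

text \<open>\<open>Q\<close> is the set of vertices that come before the listed parts, in the order of coloring.\<close>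

primrec bounded_back_degree ::
    "'a set set \<Rightarrow> real \<Rightarrow> 'a set \<Rightarrow> 'a set list \<Rightarrow> bool" where
  "bounded_back_degree E b Q [] \<longleftrightarrow> True"
| "bounded_back_degree E b Q (R # Rs) \<longleftrightarrow>
     finite R \<and> R \<inter> Q = {} \<and> (\<forall>v\<in>R. real (card (nbrs E (Q \<union> R) v)) \<le> b) \<and>
     bounded_back_degree E b (Q \<union> R) Rs"

lemma bounded_back_degree_disjoint:
  "bounded_back_degree E b Q Rs \<Longrightarrow> Q \<inter> \<Union>(set Rs) = {}"
proof (induction Rs arbitrary: Q)
  case (Cons R Rs)
  from Cons.IH[of "Q \<union> R"] Cons.prems show ?case by auto
qed simp

text \<open>\<open>D\<close> stays equal to the degree inside the remaining set \<open>U\<close>. A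
  vertex of \<open>R\<close> thus has at most \<open>(1 + \<eta>) * \<delta>\<close> neighbors in
  \<open>U\<close>, which is exactly the set of vertices colored before or together with it.\<close>

lemma adg_bounded_back_degree:
  assumes G: "simple_graph V E" and \<eta>: "0 \<le> \<eta>"
  obtains Rs where "adg V E \<eta> = Some Rs" "\<Union>(set Rs) = V"
    "bounded_back_degree E ((1 + \<eta>) * (2 * real (degeneracy V E))) {} (rev Rs)"
proof -
  define b where "b = (1 + \<eta>) * (2 * real (degeneracy V E))"
  \<comment> \<open>The removed parts, read backwards, are colored after the remaining set, so
    \<open>U\<close> takes the place of \<open>Q\<close>. A step then merely splits \<open>U\<close>
    into the new \<open>U - R\<close> and the next part \<open>R\<close>.\<close>
  define I where "I = (\<lambda>(U, D, Rs). U \<union> \<Union>(set Rs) = V \<and>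
     (\<forall>u\<in>U. D u = int (card (nbrs E U u))) \<and> bounded_back_degree E b U (rev Rs))"
  have finV: "finite V" using G by (simp add: simple_graph_def)
  let ?s = "(V, (\<lambda>v. int (card (nbrs E V v))), []) :: 'a set \<times> ('a \<Rightarrow> int) \<times> 'a set list"
  let ?c = "\<lambda>(U, D, Rs). U \<noteq> {}"
  have init: "I ?s" by (simp add: I_def)
  have step: "I (adg_step E \<eta> s) \<and> card (fst (adg_step E \<eta> s)) < card (fst s)"
    if "I s" "?c s" for s
  proof -
    obtain U D Rs where s: "s = (U, D, Rs)" by (cases s) auto
    have U: "U \<noteq> {}" and part: "U \<union> \<Union>(set Rs) = V"
      and D: "\<And>u. u \<in> U \<Longrightarrow> D u = int (card (nbrs E U u))"
      and bdeg: "bounded_back_degree E b U (rev Rs)"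
      using that by (auto simp: s I_def)
    have UV: "U \<subseteq> V" using part by blast
    have finU: "finite U" using finV UV finite_subset by blast
    define \<delta> where "\<delta> = (\<Sum>v\<in>U. real_of_int (D v)) / real (card U)"
    define R where "R = {u \<in> U. real_of_int (D u) \<le> (1 + \<eta>) * \<delta>}"
    have sum: "(\<Sum>v\<in>U. real_of_int (D v)) = real (\<Sum>v\<in>U. card (nbrs E U v))"
      using D by simp
    have cU: "card U > 0" using U finU by (simp add: card_gt_0_iff)
    have "\<delta> \<ge> 0" unfolding \<delta>_def sum by (intro divide_nonneg_nonneg of_nat_0_le_iff)
    have "real (\<Sum>v\<in>U. card (nbrs E U v)) \<le> real (2 * degeneracy V E * card U)"
      using sum_degrees_le[OF G UV] of_nat_mono by blast
    hence "\<delta> \<le> 2 * real (degeneracy V E)"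
      unfolding \<delta>_def sum using cU by (simp add: divide_le_eq)
    hence \<delta>b: "(1 + \<eta>) * \<delta> \<le> b" unfolding b_def using \<eta> by (intro mult_left_mono) auto
    \<comment> \<open>Not every vertex can have degree above the average. Since
      \<open>\<delta>\<close> and \<open>\<eta>\<close> are nonnegative, the threshold is at least
      the average, so each step removes a vertex and \<open>card U\<close> is a termination
      measure.\<close>
    have "R \<noteq> {}"
    proof
      assume "R = {}"
      hence "\<delta> < real_of_int (D v)" if "v \<in> U" for v
        using that \<open>\<delta> \<ge> 0\<close> \<eta> mult_right_mono[of 1 "1 + \<eta>" \<delta>] by (force simp: R_def)
      hence "(\<Sum>v\<in>U. \<delta>) < (\<Sum>v\<in>U. real_of_int (D v))"
        using U finU by (intro sum_strict_mono) auto
      thus False using cU by (simp add: \<delta>_def)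
    qed
    have RU: "R \<subseteq> U" by (auto simp: R_def)
    have finR: "finite R" using RU finU finite_subset by blast
    have step: "adg_step E \<eta> s =
      (U - R, (\<lambda>u. if u \<in> U then D u - int (card (nbrs E R u)) else D u), Rs @ [R])"
      unfolding R_def \<delta>_def unfolding s adg_step_def Let_def case_prod_conv by (rule refl)
    have UR: "U - R \<union> R = U" "U \<union> R = U" using RU by blast+
    have "card (nbrs E U u) = card (nbrs E (U - R) u) + card (nbrs E R u)" for u
      using card_nbrs_Un[of "U - R" R E u] finU finR UR(1) by auto
    moreover have "real (card (nbrs E U u)) \<le> b" if "u \<in> R" for u
    proof -
      have "real_of_int (D u) \<le> (1 + \<eta>) * \<delta>" "u \<in> U" using that by (auto simp: R_def)
      thus ?thesis using D[of u] \<delta>b by simp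
    qed
    ultimately have "I (adg_step E \<eta> s)"
      using part bdeg D finR RU by (auto simp: step I_def UR)
    moreover have "card (U - R) < card U"
      using \<open>R \<noteq> {}\<close> RU finU by (intro psubset_card_mono) auto
    ultimately show ?thesis unfolding step by (simp add: s)
  qed
  obtain t where t: "while_option ?c (adg_step E \<eta>) ?s = Some t"
    using measure_while_option_Some[of I ?c "adg_step E \<eta>" "\<lambda>s. card (fst s)" ?s] step init by blast
  obtain U D Rs where tt: "t = (U, D, Rs)" by (cases t) auto
  have "I t" using while_option_rule[of I ?c, OF _ t init] step by blast
  moreover have "U = {}" using while_option_stop[OF t] by (simp add: tt)
  ultimately show ?thesis using t that[of Rs] by (simp add: tt I_def adg_def b_def)
qed

section \<open>SIM-COL\<close>

text \<open>Having support inside a fixed set is an admissible property, and the empty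
  subdistribution has it. Fixpoint induction therefore covers every outcome that the loop can
  return, whether or not it terminates almost surely.\<close>

lemma sim_col_loop_invariant:
  assumes inv: "I s"
    and step: "\<And>s c. I s \<Longrightarrow> fst s \<noteq> {} \<Longrightarrow>
      c \<in> set_pmf (Pi_pmf (fst s) 0 (\<lambda>v. pmf_of_set {1..k v})) \<Longrightarrow> I (sim_col_update E c s)"
    and x: "x \<in> set_spmf (sim_col_loop E k s)"
  shows "I ({}, x)"
proof -
  have "\<forall>s. I s \<longrightarrow> set_spmf (sim_col_loop E k s) \<subseteq> {x. I ({}, x)}"
  proof (induction rule: sim_col_loop.fixp_induct)
    case 1
    show ?case by (simp add: curry_def)
  next
    case 2
    show ?case by simp
  next
    case (3 f)
    show ?case
    proof (intro allI impI)
      fix s assume s: "I s"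
      show "set_spmf (if fst s = {} then return_spmf (snd s)
        else spmf_of_pmf (Pi_pmf (fst s) 0 (\<lambda>v. pmf_of_set {1..k v})) \<bind>
          (\<lambda>c. f E k (sim_col_update E c s))) \<subseteq> {x. I ({}, x)}"
      proof (cases "fst s = {}")
        case True
        thus ?thesis using s by (cases s) simp
      next
        case False
        have "set_spmf (f E k (sim_col_update E c s)) \<subseteq> {x. I ({}, x)}"
          if "c \<in> set_pmf (Pi_pmf (fst s) 0 (\<lambda>v. pmf_of_set {1..k v}))" for c
          using 3 step[OF s False that] by blast
        thus ?thesis using False
          by (simp add: set_bind_spmf bind_UNION UN_subset_iff del: bind_spmf_of_pmf)
      qed
    qed
  qed
  thus ?thesis using inv x by blast
qed

text \<open>\<open>R - U\<close> is the set of vertices colored in this run. The last conjunct is an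
  equality because both directions matter: the forbidden sets must be large enough for properness
  and small enough for termination.\<close>

definition sim_col_inv :: "'a set set \<Rightarrow> ('a \<Rightarrow> nat) \<Rightarrow> 'a set \<Rightarrow> ('a \<Rightarrow> nat) \<Rightarrow>
    ('a \<Rightarrow> nat set) \<Rightarrow> 'a set \<times> ('a \<Rightarrow> nat) \<times> ('a \<Rightarrow> nat set) \<Rightarrow> bool" where
  "sim_col_inv E k R C\<^sub>0 B\<^sub>0 = (\<lambda>(U, C, B). U \<subseteq> R \<and>
     (\<forall>v. v \<notin> R \<longrightarrow> C v = C\<^sub>0 v \<and> B v = B\<^sub>0 v) \<and>
     (\<forall>v\<in>R - U. C v \<in> {1..k v} - B\<^sub>0 v) \<and>
     (\<forall>v\<in>R - U. \<forall>u\<in>nbrs E (R - U) v. C u \<noteq> C v) \<and>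
     (\<forall>v\<in>U. B v = B\<^sub>0 v \<union> C ` nbrs E (R - U) v))"

text \<open>Of two neighbors in \<open>U\<close> that draw the same color both are reset, so newly
  colored vertices do not conflict; a conflict with an earlier vertex of \<open>R - U\<close> is
  excluded by the forbidden set.\<close>

lemma sim_col_inv_update:
  assumes inv: "sim_col_inv E k R C\<^sub>0 B\<^sub>0 (U, C, B)"
    and c: "\<And>v. v \<in> U \<Longrightarrow> c v \<in> {1..k v}"
  shows "sim_col_inv E k R C\<^sub>0 B\<^sub>0 (sim_col_update E c (U, C, B))"
proof -
  define S where "S = {v \<in> U. (\<forall>u\<in>nbrs E U v. c u \<noteq> c v) \<and> c v \<notin> B v}"
  define C' where "C' = (\<lambda>v. if v \<in> U
    then (if (\<exists>u\<in>nbrs E U v. c u = c v) \<or> c v \<in> B v then 0 else c v) else C v)"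
  define B' where "B' = (\<lambda>v. if v \<in> U then B v \<union> {C' u | u. u \<in> nbrs E U v \<and> C' u > 0} else B v)"
  \<comment> \<open>Drawn colors are at least 1, so the value 0 in \<open>C'\<close> identifies
    exactly the reset vertices.\<close>
  have S: "{v \<in> U. C' v > 0} = S"
    using c by (force simp: S_def C'_def split: if_splits)
  have upd: "sim_col_update E c (U, C, B) = (U - S, C', B')"
    unfolding S[symmetric] B'_def unfolding C'_def sim_col_update_def Let_def case_prod_conv
    by (rule refl)
  have UR: "U \<subseteq> R" and out: "\<And>v. v \<notin> R \<Longrightarrow> C v = C\<^sub>0 v \<and> B v = B\<^sub>0 v"
    and col: "\<And>v. v \<in> R - U \<Longrightarrow> C v \<in> {1..k v} - B\<^sub>0 v"
    and proper: "\<And>u v. v \<in> R - U \<Longrightarrow> u \<in> nbrs E (R - U) v \<Longrightarrow> C u \<noteq> C v"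
    and B: "\<And>v. v \<in> U \<Longrightarrow> B v = B\<^sub>0 v \<union> C ` nbrs E (R - U) v"
    using inv by (auto simp: sim_col_inv_def)
  have C'_S: "C' v = c v" if "v \<in> S" for v using that by (auto simp: C'_def S_def)
  have C'_out: "C' v = C v" if "v \<notin> U" for v using that by (simp add: C'_def)
  have diff: "R - (U - S) = (R - U) \<union> S" using UR by (auto simp: S_def)
  have SU: "S \<subseteq> U" by (auto simp: S_def)
  have mixed: "C' u \<noteq> C' v" if "u \<in> S" "v \<in> R - U" "{u, v} \<in> E" for u v
  proof -
    have "v \<in> nbrs E (R - U) u" using that by (simp add: nbrs_def insert_commute)
    hence "C v \<in> B u" using B[of u] that SU by auto
    thus ?thesis using that C'_S[of u] C'_out[of v] by (auto simp: S_def)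
  qed
  have "C' u \<noteq> C' v" if "v \<in> R - (U - S)" "u \<in> nbrs E (R - (U - S)) v" for u v
  proof -
    have e: "{u, v} \<in> E" "{v, u} \<in> E" "u \<in> (R - U) \<union> S" "v \<in> (R - U) \<union> S"
      using that unfolding diff by (auto simp: nbrs_def insert_commute)
    consider "u \<in> S" "v \<in> S" | "u \<in> S" "v \<in> R - U" | "v \<in> S" "u \<in> R - U" | "u \<in> R - U" "v \<in> R - U"
      using e by blast
    thus ?thesis
    proof cases
      case 1
      hence "u \<in> nbrs E U v" using e SU by (auto simp: nbrs_def)
      thus ?thesis using 1 C'_S by (auto simp: S_def)
    next
      case 2 thus ?thesis using mixed e by blast
    next
      case 3 thus ?thesis using mixed[of v u] e by metis
    next
      case 4 thus ?thesis using proper[of v u] e C'_out by (auto simp: nbrs_def)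
    qed
  qed
  moreover have "C' v \<in> {1..k v} - B\<^sub>0 v" if "v \<in> R - (U - S)" for v
  proof (cases "v \<in> S")
    case True
    hence "c v \<notin> B\<^sub>0 v" using B[of v] by (auto simp: S_def)
    thus ?thesis using True c[of v] C'_S SU by auto
  next
    case False thus ?thesis using that col[of v] C'_out[of v] by auto
  qed
  moreover have "B' v = B\<^sub>0 v \<union> C' ` nbrs E (R - (U - S)) v" if "v \<in> U - S" for v
  proof -
    have "{C' u | u. u \<in> nbrs E U v \<and> C' u > 0} = C' ` nbrs E S v"
      unfolding S[symmetric] by (auto simp: nbrs_def)
    moreover have "C' ` nbrs E (R - U) v = C ` nbrs E (R - U) v"
      by (intro image_cong) (auto simp: nbrs_def C'_out)
    ultimately show ?thesis using that B[of v] by (auto simp: B'_def diff nbrs_Un image_Un)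
  qed
  moreover have "C' v = C\<^sub>0 v \<and> B' v = B\<^sub>0 v" if "v \<notin> R" for v
    using that UR out[of v] by (auto simp: C'_def B'_def)
  ultimately show ?thesis unfolding upd sim_col_inv_def using UR by auto
qed

text \<open>Positive palette sizes make the ranges nonempty, so that \<open>pmf_of_set\<close> has
  the expected support; outside \<open>U\<close> a draw has the default value 0 of
  \<open>Pi_pmf\<close>.\<close>

lemma set_draw:
  assumes "finite U" "\<And>v. v \<in> U \<Longrightarrow> k v > 0"
  shows "c \<in> set_pmf (Pi_pmf U 0 (\<lambda>v. pmf_of_set {1..k v :: nat})) \<longleftrightarrow>
    (\<forall>v\<in>U. c v \<in> {1..k v}) \<and> (\<forall>v. v \<notin> U \<longrightarrow> c v = 0)"
proof -
  have "set_pmf (pmf_of_set {1..k v}) = {1..k v}" if "v \<in> U" for v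
    using assms(2)[OF that] by (intro set_pmf_of_set) auto
  thus ?thesis using assms(1) by (auto simp: set_Pi_pmf PiE_dflt_def)
qed

lemma sim_col_loop_inv:
  assumes "finite R" "\<And>v. v \<in> R \<Longrightarrow> k v > 0"
    and "sim_col_inv E k R C\<^sub>0 B\<^sub>0 s" "x \<in> set_spmf (sim_col_loop E k s)"
  shows "sim_col_inv E k R C\<^sub>0 B\<^sub>0 ({}, x)"
proof (rule sim_col_loop_invariant[where I = "sim_col_inv E k R C\<^sub>0 B\<^sub>0", OF assms(3) _ assms(4)])
  fix s :: "'a set \<times> ('a \<Rightarrow> nat) \<times> ('a \<Rightarrow> nat set)" and c
  assume inv: "sim_col_inv E k R C\<^sub>0 B\<^sub>0 s"
    and c: "c \<in> set_pmf (Pi_pmf (fst s) 0 (\<lambda>v. pmf_of_set {1..k v}))"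
  obtain U C B where s: "s = (U, C, B)" by (cases s) auto
  have U: "U \<subseteq> R" using inv by (auto simp: s sim_col_inv_def)
  hence "finite U" using assms(1) finite_subset by blast
  hence "c v \<in> {1..k v}" if "v \<in> U" for v
    using that c set_draw[of U k c] assms(2) U unfolding s fst_conv by blast
  thus "sim_col_inv E k R C\<^sub>0 B\<^sub>0 (sim_col_update E c s)"
    using sim_col_inv_update inv unfolding s by blast
qed

section \<open>Almost sure termination of SIM-COL\<close>

lemma exists_color:
  assumes "finite B" "card B < k"
  shows "\<exists>a\<in>{1..k::nat}. a \<notin> B"
proof (rule ccontr)
  assume "\<not> ?thesis"
  hence "card {1..k} \<le> card B" using assms(1) by (intro card_mono) auto
  thus False using assms(2) by simp
qed

lemma exists_progressing_draw:
  assumes fin: "finite R" and irr: "\<And>v. v \<notin> nbrs E R v"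
    and k: "\<And>v. v \<in> R \<Longrightarrow> finite (B\<^sub>0 v) \<and> card (B\<^sub>0 v) + card (nbrs E R v) < k v"
    and inv: "sim_col_inv E k R C\<^sub>0 B\<^sub>0 (U, C, B)" and U: "U \<noteq> {}"
  shows "\<exists>c\<in>set_pmf (Pi_pmf U 0 (\<lambda>v. pmf_of_set {1..k v})).
    fst (sim_col_update E c (U, C, B)) \<subset> U"
proof -
  have UR: "U \<subseteq> R" and B: "\<And>v. v \<in> U \<Longrightarrow> B v = B\<^sub>0 v \<union> C ` nbrs E (R - U) v"
    using inv by (auto simp: sim_col_inv_def)
  have finU: "finite U" using UR fin finite_subset by blast
  obtain w where w: "w \<in> U" using U by blast
  \<comment> \<open>Besides the initial forbidden colors, \<open>B w\<close> holds at most one color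
    per neighbor in \<open>R\<close>, so the palette of \<open>w\<close> is not exhausted.\<close>
  have "card (B w) \<le> card (B\<^sub>0 w) + card (C ` nbrs E (R - U) w)"
    unfolding B[OF w] by (rule card_Un_le)
  also have "card (C ` nbrs E (R - U) w) \<le> card (nbrs E (R - U) w)"
    using fin by (intro card_image_le) auto
  also have "card (nbrs E (R - U) w) \<le> card (nbrs E R w)"
    using fin by (intro card_mono) (auto simp: nbrs_def)
  finally have "card (B w) < k w" using k[of w] w UR by auto
  moreover have "finite (B w)" using B[OF w] k[of w] w UR fin by auto
  ultimately obtain a where a: "a \<in> {1..k w}" "a \<notin> B w" using exists_color by blast
  \<comment> \<open>A neighbor \<open>u\<close> of \<open>w\<close> has \<open>w\<close> itself as a
    neighbor in \<open>R\<close>, so its degree there is positive and \<open>k u\<close> is at least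
    2.\<close>
  have nb: "\<exists>a'\<in>{1..k u}. a' \<notin> {a}" if "u \<in> nbrs E U w" for u
  proof (rule exists_color)
    have "w \<in> nbrs E R u" using that w UR by (auto simp: nbrs_def insert_commute)
    hence "card (nbrs E R u) > 0" using fin by (auto simp: card_gt_0_iff)
    thus "card {a} < k u" using k[of u] that UR by (auto simp: nbrs_def)
  qed simp
  \<comment> \<open>Only \<open>w\<close> has to succeed, so the remaining vertices of
    \<open>U\<close> may take any color in range, here 1; 0 is the default outside
    \<open>U\<close>.\<close>
  define c where "c = (\<lambda>u. if u \<in> nbrs E U w then (SOME a'. a' \<in> {1..k u} \<and> a' \<notin> {a})
    else if u = w then a else if u \<in> U then 1 else 0)"
  have cn: "c u \<in> {1..k u} \<and> c u \<notin> {a}" if "u \<in> nbrs E U w" for u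
    using someI_ex[OF nb[OF that, unfolded Bex_def]] that by (simp add: c_def)
  have wn: "w \<notin> nbrs E U w" using irr[of w] UR by (auto simp: nbrs_def)
  hence cw: "c w = a" by (simp add: c_def)
  have kpos: "k v > 0" if "v \<in> U" for v using k[of v] that UR by auto
  have "c v \<in> {1..k v}" if "v \<in> U" for v
    using cn[of v] a(1) kpos[OF that] that by (cases "v \<in> nbrs E U w") (auto simp: c_def)
  moreover have "c v = 0" if "v \<notin> U" for v using that w by (auto simp: c_def nbrs_def)
  ultimately have "c \<in> set_pmf (Pi_pmf U 0 (\<lambda>v. pmf_of_set {1..k v}))"
    by (subst set_draw) (auto simp: finU kpos)
  moreover have "\<not> ((\<exists>u\<in>nbrs E U w. c u = c w) \<or> c w \<in> B w)"
    using cn a cw by auto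
  hence "w \<notin> fst (sim_col_update E c (U, C, B))"
    using a cw w by (auto simp: sim_col_update_def Let_def)
  moreover have "fst (sim_col_update E c (U, C, B)) \<subseteq> U"
    by (auto simp: sim_col_update_def Let_def)
  ultimately show ?thesis using w by blast
qed

text \<open>A pass that colors no vertex only erases the colors on \<open>U\<close>, and the next pass overwrites
  these anyway. So the nontermination probability \<open>x\<close> satisfies \<open>x = x p\<close> with \<open>p < 1\<close>, once the
  loop is known to terminate from smaller \<open>U\<close>.\<close>

lemma sim_col_loop_stuck:
  assumes "fst (sim_col_update E c (U, C, B)) = U" "U \<noteq> {}"
  shows "sim_col_loop E k (sim_col_update E c (U, C, B)) = sim_col_loop E k (U, C, B)"
proof -
  define C' where "C' = (\<lambda>v. if v \<in> U
    then (if (\<exists>u\<in>nbrs E U v. c u = c v) \<or> c v \<in> B v then 0 else c v) else C v)"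
  define B' where "B' = (\<lambda>v. if v \<in> U then B v \<union> {C' u | u. u \<in> nbrs E U v \<and> C' u > 0} else B v)"
  have upd: "sim_col_update E c (U, C, B) = (U - {v \<in> U. C' v > 0}, C', B')"
    unfolding B'_def unfolding C'_def sim_col_update_def Let_def case_prod_conv by (rule refl)
  have stuck: "U - {v \<in> U. C' v > 0} = U" using assms(1) upd by simp
  hence zero: "C' v = 0" if "v \<in> U" for v using that by (metis (lifting) DiffD2 mem_Collect_eq gr0I)
  have "B' = B" unfolding B'_def using zero by (auto simp: nbrs_def fun_eq_iff)
  moreover have "C' v = C v" if "v \<notin> U" for v using that by (simp add: C'_def)
  ultimately have "sim_col_update E c' (U, C', B') = sim_col_update E c' (U, C, B)" for c'
    by (simp add: sim_col_update_def Let_def cong: if_cong)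
  \<comment> \<open>Unfold both loops once: they have the same \<open>U\<close>, hence the same
    distribution of draws, and every draw leads to the same next state.\<close>
  thus ?thesis unfolding upd stuck using assms(2)
    by (subst (1 2) sim_col_loop.simps) simp
qed

lemma lossless_sim_col_loop:
  assumes fin: "finite R" and irr: "\<And>v. v \<notin> nbrs E R v"
    and k: "\<And>v. v \<in> R \<Longrightarrow> finite (B\<^sub>0 v) \<and> card (B\<^sub>0 v) + card (nbrs E R v) < k v"
    and inv: "sim_col_inv E k R C\<^sub>0 B\<^sub>0 s"
  shows "lossless_spmf (sim_col_loop E k s)"
proof -
  have "finite (fst s)" using inv fin finite_subset by (fastforce simp: sim_col_inv_def)
  thus ?thesis using inv
  proof (induction "fst s" arbitrary: s rule: finite_psubset_induct)
    case psubset
    obtain U C B where s: "s = (U, C, B)" by (cases s) auto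
    have finU: "finite U" using psubset.hyps(1) by (simp add: s)
    show ?case
    proof (cases "U = {}")
      case True
      thus ?thesis by (simp add: s sim_col_loop.simps)
    next
      case False
      let ?D = "Pi_pmf U 0 (\<lambda>v. pmf_of_set {1..k v})"
      let ?upd = "\<lambda>c. sim_col_update E c (U, C, B)"
      let ?x = "pmf (sim_col_loop E k s) None"
      let ?stuck = "{c. fst (?upd c) = U}"
      have UR: "U \<subseteq> R" using psubset.prems by (auto simp: s sim_col_inv_def)
      have kpos: "k v > 0" if "v \<in> U" for v using k[of v] that UR by auto
      \<comment> \<open>After a pass without progress the nontermination probability is again
        \<open>?x\<close>; after any other pass it is 0 by the induction hypothesis for the smaller
        set.\<close>
      have upd: "pmf (sim_col_loop E k (?upd c)) None = ?x * indicator ?stuck c"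
        if "c \<in> set_pmf ?D" for c
      proof (cases "c \<in> ?stuck")
        case True
        thus ?thesis using sim_col_loop_stuck[of E c U C B k] False by (simp add: s)
      next
        case nstuck: False
        have "fst (?upd c) \<subseteq> U" by (auto simp: sim_col_update_def Let_def)
        hence "fst (?upd c) \<subset> U" using nstuck by auto
        moreover have "sim_col_inv E k R C\<^sub>0 B\<^sub>0 (?upd c)"
          using psubset.prems that set_draw[of U k c] finU kpos unfolding s
          by (intro sim_col_inv_update) blast+
        ultimately have "lossless_spmf (sim_col_loop E k (?upd c))"
          using psubset.hyps(2)[of "?upd c"] by (simp add: s)
        thus ?thesis using nstuck by (simp add: lossless_iff_pmf_None)
      qed
      have "sim_col_loop E k s = spmf_of_pmf ?D \<bind> (\<lambda>c. sim_col_loop E k (?upd c))"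
        using False by (subst sim_col_loop.simps) (simp add: s)
      hence "sim_col_loop E k s = bind_pmf ?D (\<lambda>c. sim_col_loop E k (?upd c))"
        by (simp add: bind_spmf_of_pmf)
      hence "?x = (\<integral>c. pmf (sim_col_loop E k (?upd c)) None \<partial>measure_pmf ?D)"
        by (simp add: pmf_bind)
      also have "\<dots> = (\<integral>c. ?x * indicator ?stuck c \<partial>measure_pmf ?D)"
        using upd by (intro integral_cong_AE) (auto simp: AE_measure_pmf_iff)
      also have "\<dots> = ?x * measure_pmf.prob ?D ?stuck" by simp
      finally have eq: "?x = ?x * measure_pmf.prob ?D ?stuck" .
      \<comment> \<open>Probability 1 would place the whole support inside \<open>?stuck\<close>,
        but some draw in the support makes progress.\<close>
      have "measure_pmf.prob ?D ?stuck \<noteq> 1"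
      proof
        assume "measure_pmf.prob ?D ?stuck = 1"
        hence "set_pmf ?D \<subseteq> ?stuck" by (simp add: measure_pmf.prob_eq_1 AE_measure_pmf_iff subset_iff)
        thus False
          using exists_progressing_draw[OF fin irr k _ False, of C\<^sub>0 C B] psubset.prems
          by (auto simp: s)
      qed
      thus ?thesis using eq by (simp add: lossless_iff_pmf_None)
    qed
  qed
qed

section \<open>DEC-ADG\<close>

text \<open>For positive degree, \<open>\<mu> > 0\<close> makes the real bound exceed an integer, so
  its ceiling does too, however small \<open>\<mu>\<close> is; for degree 0 the \<open>max 1\<close>
  gives strictness.\<close>

lemma palette_size_gt: "\<mu> > 0 \<Longrightarrow> card (nbrs E W v) < palette_size E \<mu> W v"
proof (cases "card (nbrs E W v) = 0")
  case False
  assume "\<mu> > 0"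
  hence "real (card (nbrs E W v)) < (1 + \<mu>) * real (card (nbrs E W v))"
    using False by (simp add: distrib_right)
  hence "card (nbrs E W v) < nat \<lceil>(1 + \<mu>) * real (card (nbrs E W v))\<rceil>" by linarith
  thus ?thesis by (simp add: palette_size_def)
qed (simp add: palette_size_def)

lemma palette_size_le:
  assumes "\<mu> \<ge> 0" "real (card (nbrs E W v)) \<le> b"
  shows "palette_size E \<mu> W v \<le> max 1 (nat \<lceil>(1 + \<mu>) * b\<rceil>)"
proof -
  have "(1 + \<mu>) * real (card (nbrs E W v)) \<le> (1 + \<mu>) * b"
    using assms by (intro mult_left_mono) auto
  thus ?thesis unfolding palette_size_def by (intro max.mono nat_mono ceiling_mono) auto
qed

text \<open>The initial forbidden sets hold exactly the colors of the neighbors in \<open>Q\<close>.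
  This keeps edges between \<open>Q\<close> and \<open>R\<close> proper, and it bounds forbidden
  colors plus neighbors in \<open>R\<close> by the degree in \<open>Q \<union> R\<close>, which is
  below the palette size.\<close>

lemma sim_col_correct:
  fixes C :: "'a \<Rightarrow> nat" and \<mu> :: real
  assumes G: "simple_graph V E" and \<mu>: "\<mu> > 0"
    and fin: "finite Q" "finite R" and disj: "R \<inter> Q = {}"
    and bdeg: "\<And>v. v \<in> R \<Longrightarrow> real (card (nbrs E (Q \<union> R) v)) \<le> b"
    and B: "\<And>v. v \<in> R \<Longrightarrow> B v = C ` nbrs E Q v"
    and C: "proper_coloring Q E C"
  shows "lossless_spmf (sim_col E \<mu> Q R C B)"
    and "(C', B') \<in> set_spmf (sim_col E \<mu> Q R C B) \<Longrightarrow>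
      proper_coloring (Q \<union> R) E C' \<and> (\<forall>v\<in>R. C' v \<le> max 1 (nat \<lceil>(1 + \<mu>) * b\<rceil>)) \<and>
      (\<forall>v. v \<notin> R \<longrightarrow> C' v = C v \<and> B' v = B v)"
proof -
  let ?k = "palette_size E \<mu> (Q \<union> R)"
  have k: "finite (B v) \<and> card (B v) + card (nbrs E R v) < ?k v" if "v \<in> R" for v
  proof -
    have "card (B v) \<le> card (nbrs E Q v)" unfolding B[OF that] using fin by (intro card_image_le) auto
    moreover have "card (nbrs E Q v) + card (nbrs E R v) = card (nbrs E (Q \<union> R) v)"
      using fin disj by (subst card_nbrs_Un) auto
    ultimately show ?thesis using palette_size_gt[OF \<mu>, of E "Q \<union> R" v] B[OF that] fin by auto
  qed
  have inv: "sim_col_inv E ?k R C B (R, C, B)" by (auto simp: sim_col_inv_def nbrs_def)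
  show "lossless_spmf (sim_col E \<mu> Q R C B)"
    unfolding sim_col_def by (rule lossless_sim_col_loop[OF fin(2) nbrs_irrefl[OF G] k inv])
  assume "(C', B') \<in> set_spmf (sim_col E \<mu> Q R C B)"
  moreover have "?k v > 0" for v by (simp add: palette_size_def)
  ultimately have "sim_col_inv E ?k R C B ({}, C', B')"
    unfolding sim_col_def using sim_col_loop_inv[OF fin(2) _ inv] by blast
  hence out: "\<And>v. v \<notin> R \<Longrightarrow> C' v = C v \<and> B' v = B v"
    and col: "\<And>v. v \<in> R \<Longrightarrow> C' v \<in> {1..?k v} - B v"
    and proper: "\<And>u v. v \<in> R \<Longrightarrow> u \<in> nbrs E R v \<Longrightarrow> C' u \<noteq> C' v"
    by (auto simp: sim_col_inv_def)
  have mixed: "C' u \<noteq> C' v" if "u \<in> R" "v \<in> Q" "{v, u} \<in> E" for u v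
  proof -
    have "C v \<in> B u" using B[OF that(1)] that by (auto simp: nbrs_def)
    moreover have "C' v = C v" using out[of v] that disj by blast
    ultimately show ?thesis using col[OF that(1)] by auto
  qed
  have "C' u \<noteq> C' v" if uv: "u \<in> Q \<union> R" "v \<in> Q \<union> R" "{u, v} \<in> E" for u v
  proof -
    have sym: "{v, u} \<in> E" using uv(3) by (simp add: insert_commute)
    consider "u \<in> R" "v \<in> R" | "u \<in> R" "v \<in> Q" | "u \<in> Q" "v \<in> R" | "u \<in> Q - R" "v \<in> Q - R"
      using uv(1,2) disj by blast
    thus ?thesis
    proof cases
      case 1 thus ?thesis using proper[of v u] uv(3) by (simp add: nbrs_def)
    next
      case 2 thus ?thesis using mixed sym by blast
    next
      case 3 thus ?thesis using mixed[of v u] uv(3) by metis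
    next
      case 4 thus ?thesis using out[of u] out[of v] C uv(3) by (simp add: proper_coloring_def)
    qed
  qed
  moreover have "C' v > 0" if "v \<in> Q \<union> R" for v
    using that col[of v] out[of v] C by (cases "v \<in> R") (auto simp: proper_coloring_def)
  ultimately have "proper_coloring (Q \<union> R) E C'" by (auto simp: proper_coloring_def)
  moreover have "C' v \<le> max 1 (nat \<lceil>(1 + \<mu>) * b\<rceil>)" if "v \<in> R" for v
    using col[OF that] palette_size_le[OF less_imp_le[OF \<mu>] bdeg[OF that]] by (meson DiffD1 atLeastAtMost_iff le_trans)
  ultimately show "proper_coloring (Q \<union> R) E C' \<and> (\<forall>v\<in>R. C' v \<le> max 1 (nat \<lceil>(1 + \<mu>) * b\<rceil>)) \<and>
      (\<forall>v. v \<notin> R \<longrightarrow> C' v = C v \<and> B' v = B v)"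
    using out by blast
qed

text \<open>Vertices of unprocessed parts must still have empty forbidden sets, so that the colors
  inserted at the start of their own phase are all that these sets contain. The \<open>max 1\<close>
  in \<open>N\<close> accounts for vertices with the single color 1.\<close>

lemma color_partitions_correct:
  assumes G: "simple_graph V E" and \<mu>: "\<mu> > 0" and N: "N = max 1 (nat \<lceil>(1 + \<mu>) * b\<rceil>)"
    and "finite Q" "bounded_back_degree E b Q Rs" "\<And>v. v \<in> \<Union>(set Rs) \<Longrightarrow> B v = {}"
    and "proper_coloring Q E C" "C ` Q \<subseteq> {1..N}"
  shows "lossless_spmf (color_partitions E \<mu> Rs Q C B) \<and>
    (\<forall>C'\<in>set_spmf (color_partitions E \<mu> Rs Q C B).
      proper_coloring (Q \<union> \<Union>(set Rs)) E C' \<and> C' ` (Q \<union> \<Union>(set Rs)) \<subseteq> {1..N})"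
  using assms(4-)
proof (induction Rs arbitrary: Q C B)
  case (Cons R Rs)
  let ?B = "\<lambda>v. if v \<in> R then B v \<union> C ` nbrs E Q v else B v"
  have finR: "finite R" and disj: "R \<inter> Q = {}"
    and bdeg: "\<And>v. v \<in> R \<Longrightarrow> real (card (nbrs E (Q \<union> R) v)) \<le> b"
    and rest: "bounded_back_degree E b (Q \<union> R) Rs"
    using Cons.prems(2) by auto
  have B: "?B v = C ` nbrs E Q v" if "v \<in> R" for v using that Cons.prems(3) by simp
  note sim_col = sim_col_correct[OF G \<mu> Cons.prems(1) finR disj bdeg B Cons.prems(4), folded N]
  have "lossless_spmf (color_partitions E \<mu> Rs (Q \<union> R) C' B') \<and>
    (\<forall>C''\<in>set_spmf (color_partitions E \<mu> Rs (Q \<union> R) C' B').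
      proper_coloring (Q \<union> R \<union> \<Union>(set Rs)) E C'' \<and> C'' ` (Q \<union> R \<union> \<Union>(set Rs)) \<subseteq> {1..N})"
    if "(C', B') \<in> set_spmf (sim_col E \<mu> Q R C ?B)" for C' B'
  proof (rule Cons.IH)
    have C': "proper_coloring (Q \<union> R) E C'" and le: "\<forall>v\<in>R. C' v \<le> N"
      and out: "\<And>v. v \<notin> R \<Longrightarrow> C' v = C v \<and> B' v = ?B v"
      using sim_col(2)[OF _ _ that] by blast+
    show "finite (Q \<union> R)" using Cons.prems(1) finR by simp
    show "bounded_back_degree E b (Q \<union> R) Rs" by (rule rest)
    show "proper_coloring (Q \<union> R) E C'" by (rule C')
    show "C' ` (Q \<union> R) \<subseteq> {1..N}"
    proof
      fix x assume "x \<in> C' ` (Q \<union> R)"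
      then obtain v where v: "v \<in> Q \<union> R" "x = C' v" by blast
      have "C' v > 0" using C' v by (simp add: proper_coloring_def)
      moreover have "C' v \<le> N"
        using v le out[of v] Cons.prems(5) by (cases "v \<in> R") auto
      ultimately show "x \<in> {1..N}" using v by simp
    qed
    \<comment> \<open>SIM-COL alters forbidden sets only on \<open>R\<close>, and later parts are
      disjoint from \<open>R\<close>.\<close>
    fix v assume "v \<in> \<Union>(set Rs)"
    moreover from this have "v \<notin> R" using bounded_back_degree_disjoint[OF rest] by blast
    ultimately show "B' v = {}" using out[of v] Cons.prems(3)[of v] by auto
  qed
  note rec = this
  have "lossless_spmf (case p of (C', B') \<Rightarrow> color_partitions E \<mu> Rs (Q \<union> R) C' B')"
    if "p \<in> set_spmf (sim_col E \<mu> Q R C ?B)" for p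
    using rec[of "fst p" "snd p"] that by (simp add: case_prod_beta)
  hence "lossless_spmf (color_partitions E \<mu> (R # Rs) Q C B)"
    unfolding color_partitions.simps lossless_bind_spmf using sim_col(1) by blast
  moreover have "proper_coloring (Q \<union> \<Union>(set (R # Rs))) E C'' \<and> C'' ` (Q \<union> \<Union>(set (R # Rs))) \<subseteq> {1..N}"
    if C'': "C'' \<in> set_spmf (color_partitions E \<mu> (R # Rs) Q C B)" for C''
  proof -
    obtain p where "p \<in> set_spmf (sim_col E \<mu> Q R C ?B)"
      "C'' \<in> set_spmf (case p of (C', B') \<Rightarrow> color_partitions E \<mu> Rs (Q \<union> R) C' B')"
      using C'' unfolding color_partitions.simps set_bind_spmf bind_UNION o_def by blast
    with rec[of "fst p" "snd p"] show ?thesis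
      unfolding list.set Union_insert Un_assoc by (simp add: case_prod_beta)
  qed
  ultimately show ?case by blast
qed simp

text \<open>Losslessness expresses almost sure termination. For \<open>d = 0\<close> the bound
  \<open>\<lceil>(2 + \<epsilon>) * real d\<rceil>\<close> is 0 although a nonempty edgeless graph
  needs one color, so this case has its own conclusion.\<close>

theorem claim2:
  fixes V :: "'a set" and E :: "'a set set" and d :: nat and \<epsilon> :: real
  assumes "simple_graph V E"
    and "d = degeneracy V E"
    and "0 < \<epsilon>" and "\<epsilon> \<le> 8"
  shows "lossless_spmf (dec_adg V E \<epsilon>) \<and>
    (\<forall>C \<in> set_spmf (dec_adg V E \<epsilon>).
       proper_coloring V E C \<and>
       (d \<ge> 1 \<longrightarrow> int (card (C ` V)) \<le> \<lceil>(2 + \<epsilon>) * real d\<rceil>) \<and>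
       (d = 0 \<longrightarrow> card (C ` V) \<le> 1))"
proof -
  define b where "b = (1 + \<epsilon> / 12) * (2 * real d)"
  define N where "N = max 1 (nat \<lceil>(1 + \<epsilon> / 4) * b\<rceil>)"
  obtain Rs where Rs: "adg V E (\<epsilon> / 12) = Some Rs" "\<Union>(set Rs) = V"
    "bounded_back_degree E b {} (rev Rs)"
    using adg_bounded_back_degree[OF assms(1), of "\<epsilon> / 12"] assms(2,3) unfolding b_def by auto
  have dec: "lossless_spmf (dec_adg V E \<epsilon>) \<and>
    (\<forall>C\<in>set_spmf (dec_adg V E \<epsilon>). proper_coloring V E C \<and> C ` V \<subseteq> {1..N})"
    using color_partitions_correct[OF assms(1) _ N_def _ Rs(3), of "\<lambda>_. {}" "\<lambda>_. 0"] assms(3) Rs(1,2)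
    by (simp add: dec_adg_def proper_coloring_def)
  have card: "card (C ` V) \<le> N" if "C ` V \<subseteq> {1..N}" for C :: "'a \<Rightarrow> nat"
    using card_mono[OF _ that] by simp
  have "int N \<le> \<lceil>(2 + \<epsilon>) * real d\<rceil>" if "d \<ge> 1"
  proof -
    \<comment> \<open>The product below expands to
      \<open>2 + 2 * \<epsilon> / 3 + \<epsilon> * \<epsilon> / 24\<close>, and
      \<open>\<epsilon> \<le> 8\<close> bounds its last term by
      \<open>\<epsilon> / 3\<close>.\<close>
    have "\<epsilon> * \<epsilon> \<le> 8 * \<epsilon>" using assms(3,4) by (intro mult_right_mono) auto
    hence "(1 + \<epsilon> / 4) * (1 + \<epsilon> / 12) * 2 \<le> 2 + \<epsilon>" by (simp add: field_simps)
    hence "(1 + \<epsilon> / 4) * (1 + \<epsilon> / 12) * 2 * real d \<le> (2 + \<epsilon>) * real d"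
      by (intro mult_right_mono) auto
    moreover have "(1 + \<epsilon> / 4) * b = (1 + \<epsilon> / 4) * (1 + \<epsilon> / 12) * 2 * real d"
      by (simp only: b_def mult.assoc)
    ultimately have "(1 + \<epsilon> / 4) * b \<le> (2 + \<epsilon>) * real d" by (simp only:)
    hence "\<lceil>(1 + \<epsilon> / 4) * b\<rceil> \<le> \<lceil>(2 + \<epsilon>) * real d\<rceil>" by (rule ceiling_mono)
    \<comment> \<open>For \<open>d \<ge> 1\<close> the target is at least 1, so it also absorbs the
      \<open>max 1\<close> in \<open>N\<close>.\<close>
    moreover have "0 < (2 + \<epsilon>) * real d" using that assms(3) by simp
    hence "1 \<le> \<lceil>(2 + \<epsilon>) * real d\<rceil>" by linarith
    ultimately show ?thesis unfolding N_def by linarith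
  qed
  moreover have "N = 1" if "d = 0" using that by (simp add: N_def b_def)
  ultimately have "(d \<ge> 1 \<longrightarrow> int (card (C ` V)) \<le> \<lceil>(2 + \<epsilon>) * real d\<rceil>) \<and> (d = 0 \<longrightarrow> card (C ` V) \<le> 1)"
    if "C ` V \<subseteq> {1..N}" for C :: "'a \<Rightarrow> nat"
    using card[OF that] by linarith
  thus ?thesis using dec by blast
qed

end
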